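(* Let $p:S\to P$ be a branched covering map between translation surfaces satisfying: (H0) $V(S)$ is a subgroup of $V(P)$; (H1) $V(S)$ has finite index in $V(P)$; (H2) $V(P)$ comes with a finite generating set $\{M_1,\dots,M_m\}$. Then Algorithm 1 (described in the context), applied to $S$ and $M_1,\dots,M_m$, terminates, and its output, consisting of words $C_1,\dots,C_n$ in the generators $M_1,\dots,M_m$ (also regarded as elements of $V(P)$), translation surfaces $S_1,\dots,S_n$ and maps $m_1,\dots,m_m$, satisfies: (C0) $S_1=S$ and $C_1=I$. (C1) $C_i(S)=S_i$ for all $i\in\{1,\dots,n\}$. (C2) $[V(P):V(S)]=n$, and the collections $\{C_iV(S)\}$ and $\{S_i\}$ enumerate $V(P)/V(S)$ and the $V(P)$-orbit of $S$, respectively. (C3) Each $m_j$ is a permutation of $\{1,\dots,n\}$, and for all $i$ and $j$, $M_j(S_i)=S_{m_j(i)}$ and $M_jC_iV(S)=C_{m_j(i)}V(S)$.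
   Context: A translation surface is a closed surface with a finite set of cone singularities and, on the complement, an atlas with translation transition functions (equivalently a compact Riemann surface with a holomorphic $1$-form and a finite set of points containing its zeros); two are considered equal if they are equivalent via an orientation-preserving homeomorphism that is a translation in charts. $SL(2,\mathbb{R})$ acts on translation surfaces by post-composing charts with the linear action on the plane. The Veech group of $S$ is $V(S)=\{A\in SL(2,\mathbb{R}):A(S)=S\}$. It is assumed that one can compute the image of a translation surface under a matrix and decide whether two translation surfaces are equal. Algorithm 1: - Let $n=1$, $S_1=S$, $C_1=I$. - Let $NF=\{1\}$ be a modifiable set of indices of newly found surfaces. - Let $m_1,\dots,m_m$ be (initially empty) dictionaries, i.e. finite editable maps. - While $NF$ is non-empty: - Remove an index $i$ from $NF$. - For each $j\in\{1,\dots,m\}$: - Set $S'=M_j(S_i)$. - If $S'$ appears in the list $S_1,\dots,S_n$: set $k$ so that $S'=S_k$ and define $m_j(i)=k$. - Otherwise: increment $n$, define $S_n=S'$ and $C_n=M_jC_i$; add $n$ to $NF$; define $m_j(i)=n$. *)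

theory Defs
  imports "HOL-Analysis.Analysis" "HOL-Algebra.Left_Coset" "HOL-Algebra.Generated_Groups"
begin

section \<open>Translation surfaces\<close>

text \<open>
  A chart is a pair of its domain and a map into the plane, which is identified with the
  complex numbers; the value of the map outside the domain is irrelevant.
\<close>

record 'a surface =
  surf_top :: "'a topology"
  sing :: "'a set"
  atlas :: "('a set \<times> ('a \<Rightarrow> complex)) set"

definition locally_translates ::
    "'a topology \<Rightarrow> 'a \<Rightarrow> ('a \<Rightarrow> complex) \<Rightarrow> ('a \<Rightarrow> complex) \<Rightarrow> bool" where
  "locally_translates X x f g \<longleftrightarrow>
     (\<exists>N c. openin X N \<and> x \<in> N \<and> (\<forall>y\<in>N. g y = f y + c))"

definition translation_atlas :: "'a surface \<Rightarrow> bool" where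
  "translation_atlas S \<longleftrightarrow>
     (\<forall>(U, \<phi>) \<in> atlas S.
        openin (surf_top S) U \<and> U \<inter> sing S = {} \<and> open (\<phi> ` U) \<and>
        homeomorphic_map (subtopology (surf_top S) U) (top_of_set (\<phi> ` U)) \<phi>) \<and>
     \<Union> (fst ` atlas S) = topspace (surf_top S) - sing S \<and>
     (\<forall>(U, \<phi>) \<in> atlas S. \<forall>(V, \<psi>) \<in> atlas S. \<forall>x \<in> U \<inter> V.
        locally_translates (surf_top S) x \<phi> \<psi>)"

text \<open>
  A cone point of angle \<open>2 * pi * k\<close>: there is a topological coordinate \<open>\<psi>\<close> centred at \<open>s\<close>
  for which \<open>\<psi> ^ k\<close> is, away from \<open>s\<close>, locally a translate of the charts
  (so the 1-form is \<open>d (w ^ k)\<close>, with a zero of order \<open>k - 1\<close>).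
  The case \<open>k = 1\<close>, a marked regular point, is allowed.
\<close>

definition cone_point :: "'a surface \<Rightarrow> 'a \<Rightarrow> bool" where
  "cone_point S s \<longleftrightarrow>
     (\<exists>k \<ge> 1. \<exists>U \<psi>.
        openin (surf_top S) U \<and> U \<inter> sing S = {s} \<and> open (\<psi> ` U) \<and>
        homeomorphic_map (subtopology (surf_top S) U) (top_of_set (\<psi> ` U)) \<psi> \<and>
        \<psi> s = 0 \<and>
        (\<forall>(V, \<phi>) \<in> atlas S. \<forall>x \<in> U \<inter> V.
           locally_translates (surf_top S) x \<phi> (\<lambda>y. \<psi> y ^ (k::nat))))"

text \<open>
  Closed surfaces are connected. Second countability is automatic, since the space is compact
  and, by the charts and the coordinates at cone points, locally Euclidean.
\<close>

definition translation_surface :: "'a surface \<Rightarrow> bool" where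
  "translation_surface S \<longleftrightarrow>
     topspace (surf_top S) \<noteq> {} \<and> compact_space (surf_top S) \<and>
     connected_space (surf_top S) \<and> Hausdorff_space (surf_top S) \<and>
     finite (sing S) \<and> sing S \<subseteq> topspace (surf_top S) \<and>
     translation_atlas S \<and> (\<forall>s \<in> sing S. cone_point S s)"

definition translation_in_charts :: "'a surface \<Rightarrow> 'b surface \<Rightarrow> ('a \<Rightarrow> 'b) \<Rightarrow> bool" where
  "translation_in_charts S T f \<longleftrightarrow>
     (\<forall>(U, \<phi>) \<in> atlas S. \<forall>(V, \<psi>) \<in> atlas T. \<forall>x \<in> U. f x \<in> V \<longrightarrow>
        locally_translates (surf_top S) x \<phi> (\<psi> \<circ> f))"

text \<open>
  Equality of translation surfaces. A homeomorphism that is a translation in charts preserves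
  the orientation defined by the charts, so no separate orientation condition is needed.
\<close>

definition same_surface :: "'a surface \<Rightarrow> 'b surface \<Rightarrow> bool" (infix \<open>\<cong>\<^sub>t\<close> 50) where
  "S \<cong>\<^sub>t T \<longleftrightarrow>
     (\<exists>f. homeomorphic_map (surf_top S) (surf_top T) f \<and> f ` sing S = sing T \<and>
          translation_in_charts S T f)"

definition surface_class :: "'a surface \<Rightarrow> 'a surface set" where
  "surface_class S = {T. translation_surface T \<and> S \<cong>\<^sub>t T}"


section \<open>Branched coverings\<close>

text \<open>The analogue of the library notion \<^const>\<open>covering_space\<close> for abstract topologies.\<close>

definition covering_map_top :: "'a topology \<Rightarrow> 'b topology \<Rightarrow> ('a \<Rightarrow> 'b) \<Rightarrow> bool" where
  "covering_map_top X Y p \<longleftrightarrow>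
     continuous_map X Y p \<and> p ` topspace X = topspace Y \<and>
     (\<forall>y \<in> topspace Y. \<exists>V. y \<in> V \<and> openin Y V \<and>
        (\<exists>\<U>. \<Union>\<U> = {x \<in> topspace X. p x \<in> V} \<and> (\<forall>U\<in>\<U>. openin X U) \<and> pairwise disjnt \<U> \<and>
             (\<forall>U\<in>\<U>. homeomorphic_map (subtopology X U) (subtopology Y V) p)))"

text \<open>
  A finite-degree branched covering, branched over a finite set \<open>B\<close>. As a map of translation
  surfaces it is a translation in charts wherever it maps a nonsingular point to a nonsingular
  point. No relation between the two singular sets is imposed.
\<close>

definition branched_covering :: "'a surface \<Rightarrow> 'b surface \<Rightarrow> ('a \<Rightarrow> 'b) \<Rightarrow> bool" where
  "branched_covering S P p \<longleftrightarrow>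
     continuous_map (surf_top S) (surf_top P) p \<and>
     p ` topspace (surf_top S) = topspace (surf_top P) \<and>
     (\<forall>y \<in> topspace (surf_top P). finite {x \<in> topspace (surf_top S). p x = y}) \<and>
     (\<exists>B. finite B \<and> B \<subseteq> topspace (surf_top P) \<and>
        covering_map_top
          (subtopology (surf_top S) {x. p x \<notin> B})
          (subtopology (surf_top P) (- B)) p) \<and>
     translation_in_charts S P p"


section \<open>The action of the special linear group and Veech groups\<close>

definition SL2R :: "(real^2^2) monoid" where
  "SL2R = \<lparr>carrier = {A. det A = 1}, mult = (**), one = mat 1\<rparr>"

definition plane_act :: "real^2^2 \<Rightarrow> complex \<Rightarrow> complex" where
  "plane_act A z = Complex (A$1$1 * Re z + A$1$2 * Im z) (A$2$1 * Re z + A$2$2 * Im z)"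

definition surface_act :: "real^2^2 \<Rightarrow> 'a surface \<Rightarrow> 'a surface" (infixr \<open>\<bullet>\<^sub>s\<close> 75) where
  "A \<bullet>\<^sub>s S = S\<lparr>atlas := (\<lambda>(U, \<phi>). (U, plane_act A \<circ> \<phi>)) ` atlas S\<rparr>"

definition veech :: "'a surface \<Rightarrow> (real^2^2) set" where
  "veech S = {A \<in> carrier SL2R. A \<bullet>\<^sub>s S \<cong>\<^sub>t S}"

definition veech_group :: "'a surface \<Rightarrow> (real^2^2) monoid" where
  "veech_group S = SL2R\<lparr>carrier := veech S\<rparr>"

text \<open>Only meaningful when there are finitely many cosets.\<close>

definition subgroup_index :: "('g, 'c) monoid_scheme \<Rightarrow> 'g set \<Rightarrow> nat" where
  "subgroup_index G H = card (lcosets\<^bsub>G\<^esub> H)"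


section \<open>The algorithm\<close>

text \<open>
  Words in the generators are lists of generator indices, the leftmost letter being the
  leftmost factor.
\<close>

definition word_matrix :: "(nat \<Rightarrow> real^2^2) \<Rightarrow> nat list \<Rightarrow> real^2^2" where
  "word_matrix M w = foldr (\<lambda>j A. M j ** A) w (mat 1)"

text \<open>
  States of the algorithm. Besides the variables \<open>n\<close>, \<open>S\<^sub>1, \<dots>, S\<^sub>n\<close>, \<open>C\<^sub>1, \<dots>, C\<^sub>n\<close>, \<open>NF\<close> and the
  dictionaries, \<open>cur\<close> is the index most recently removed from \<open>NF\<close> and \<open>todo\<close> holds those
  \<open>j\<close> for which the body of the inner loop has still to be executed. Only the values of
  \<open>surf\<close> and \<open>word\<close> at \<open>1, \<dots>, n\<close> are meaningful.
\<close>

record 'a alg_state =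
  num :: nat
  surf :: "nat \<Rightarrow> 'a surface"
  word :: "nat \<Rightarrow> nat list"
  nf :: "nat set"
  dict :: "nat \<Rightarrow> nat \<rightharpoonup> nat"
  cur :: nat
  todo :: "nat set"

definition alg_init :: "'a surface \<Rightarrow> 'a alg_state" where
  "alg_init S = \<lparr>num = 1, surf = (\<lambda>_. S), word = (\<lambda>_. []), nf = {1},
                 dict = (\<lambda>_. Map.empty), cur = 0, todo = {}\<rparr>"

text \<open>
  The relation is nondeterministic: the choice of the index removed from \<open>NF\<close>, the order in
  which the inner loop treats the generators, and the choice of \<open>k\<close> are all left open.
\<close>

inductive alg_step :: "(nat \<Rightarrow> real^2^2) \<Rightarrow> nat \<Rightarrow> 'a alg_state \<Rightarrow> 'a alg_state \<Rightarrow> bool"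
  for M :: "nat \<Rightarrow> real^2^2" and m :: nat where
  pick: "todo s = {} \<Longrightarrow> i \<in> nf s \<Longrightarrow>
    alg_step M m s (s\<lparr>nf := nf s - {i}, cur := i, todo := {1..m}\<rparr>)"
| found: "j \<in> todo s \<Longrightarrow> k \<in> {1..num s} \<Longrightarrow> M j \<bullet>\<^sub>s surf s (cur s) \<cong>\<^sub>t surf s k \<Longrightarrow>
    alg_step M m s
      (s\<lparr>dict := (dict s)(j := (dict s j)(cur s \<mapsto> k)), todo := todo s - {j}\<rparr>)"
| new: "j \<in> todo s \<Longrightarrow> \<forall>k \<in> {1..num s}. \<not> M j \<bullet>\<^sub>s surf s (cur s) \<cong>\<^sub>t surf s k \<Longrightarrow>
    n' = num s + 1 \<Longrightarrow>
    alg_step M m s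
      (s\<lparr>num := n',
         surf := (surf s)(n' := M j \<bullet>\<^sub>s surf s (cur s)),
         word := (word s)(n' := j # word s (cur s)),
         nf := insert n' (nf s),
         dict := (dict s)(j := (dict s j)(cur s \<mapsto> n')),
         todo := todo s - {j}\<rparr>)"

definition alg_reachable ::
    "(nat \<Rightarrow> real^2^2) \<Rightarrow> nat \<Rightarrow> 'a surface \<Rightarrow> 'a alg_state \<Rightarrow> bool" where
  "alg_reachable M m S s \<longleftrightarrow> (alg_step M m)\<^sup>*\<^sup>* (alg_init S) s"

definition alg_halted :: "'a alg_state \<Rightarrow> bool" where
  "alg_halted s \<longleftrightarrow> nf s = {} \<and> todo s = {}"

text \<open>Every execution is finite, and it can only end by leaving the main loop.\<close>

definition alg_terminates :: "(nat \<Rightarrow> real^2^2) \<Rightarrow> nat \<Rightarrow> 'a surface \<Rightarrow> bool" where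
  "alg_terminates M m S \<longleftrightarrow>
     (\<nexists>r. r 0 = alg_init S \<and> (\<forall>t::nat. alg_step M m (r t) (r (Suc t)))) \<and>
     (\<forall>s. alg_reachable M m S s \<and> (\<nexists>s'. alg_step M m s s') \<longrightarrow> alg_halted s)"

definition alg_output ::
    "(nat \<Rightarrow> real^2^2) \<Rightarrow> nat \<Rightarrow> 'a surface \<Rightarrow>
     nat \<Rightarrow> (nat \<Rightarrow> nat list) \<Rightarrow> (nat \<Rightarrow> 'a surface) \<Rightarrow> (nat \<Rightarrow> nat \<rightharpoonup> nat) \<Rightarrow> bool" where
  "alg_output M m S n W T d \<longleftrightarrow>
     (\<exists>s. alg_reachable M m S s \<and> alg_halted s \<and>
          n = num s \<and> W = word s \<and> T = surf s \<and> d = dict s)"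

end

theory Submission
  imports Defs
begin

text \<open>
  The algorithm is a search of the Schreier graph of \<open>V(P)\<close> acting on the orbit of \<open>S\<close>. The
  stabilizer of \<open>S\<close> is \<open>V(S)\<close>, so equality of the translates \<open>A(S)\<close> and \<open>B(S)\<close> amounts to
  equality of the cosets \<open>A V(S)\<close> and \<open>B V(S)\<close> (\<open>orbit_eq_iff_lcoset_eq\<close>). The listed surfaces
  are pairwise distinct translates \<open>C\<^sub>i(S)\<close>, hence there are never more of them than the finite
  index, and since each of them is processed once the search ends (\<open>invariant_lcosets\<close>,
  \<open>remaining_work_decreases\<close>). At that moment the list is closed under all generators. Each
  generator acts on the finite list injectively, thus bijectively (\<open>halted_dict\<close>), so the list is
  closed under the inverses too and therefore under all of \<open>V(P)\<close> (\<open>halted_orbit_closed\<close>). As it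
  contains \<open>S\<close>, it is the whole orbit, and its words represent all cosets.

  For this to make sense, \<open>\<cong>\<^sub>t\<close> has to be an equivalence relation between translation surfaces,
  and the matrices of determinant 1 have to act on translation surfaces, respecting \<open>\<cong>\<^sub>t\<close>. The point
  of substance is that \<open>A(S)\<close> is again a translation surface at its cone points
  (\<open>cone_point_surface_act\<close>). If a local coordinate \<open>\<psi>\<close> has \<open>\<psi> ^ k\<close> as flat coordinate, then
  a homeomorphic coordinate whose \<open>k\<close>-th power is \<open>A (\<psi> ^ k)\<close> is required. It is obtained by
  lifting the linear map \<open>A\<close> through \<open>w \<mapsto> w ^ k\<close> with an explicit continuous root
  (\<open>real_linear_lifts_to_power\<close>), and invariance of domain makes it a coordinate.
\<close>

section \<open>Equality of translation surfaces is an equivalence relation\<close>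

lemma locally_translates_sym:
  "locally_translates X x f g \<Longrightarrow> locally_translates X x g f"
  unfolding locally_translates_def
  by (metis add_diff_cancel diff_conv_add_uminus)

lemma locally_translates_trans:
  assumes "locally_translates X x f g" "locally_translates X x g h"
  shows "locally_translates X x f h"
proof -
  obtain N c where N: "openin X N" "x \<in> N" "\<And>y. y \<in> N \<Longrightarrow> g y = f y + c"
    using assms(1) unfolding locally_translates_def by blast
  obtain N' c' where N': "openin X N'" "x \<in> N'" "\<And>y. y \<in> N' \<Longrightarrow> h y = g y + c'"
    using assms(2) unfolding locally_translates_def by blast
  have "openin X (N \<inter> N')" "x \<in> N \<inter> N'" "\<forall>y\<in>N \<inter> N'. h y = f y + (c + c')"
    using N N' by (auto simp: add.assoc)
  then show ?thesis unfolding locally_translates_def by blast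
qed

lemma locally_translates_pullback:
  assumes "continuous_map X Y f" "x \<in> topspace X" "locally_translates Y (f x) g h"
  shows "locally_translates X x (g \<circ> f) (h \<circ> f)"
proof -
  obtain N c where N: "openin Y N" "f x \<in> N" "\<And>y. y \<in> N \<Longrightarrow> h y = g y + c"
    using assms(3) unfolding locally_translates_def by blast
  let ?N = "{y \<in> topspace X. f y \<in> N}"
  have "openin X ?N" using assms(1) N(1) by (rule openin_continuous_map_preimage)
  moreover have "x \<in> ?N" "\<forall>y\<in>?N. (h \<circ> f) y = (g \<circ> f) y + c" using N assms(2) by auto
  ultimately show ?thesis unfolding locally_translates_def by blast
qed

text \<open>
  A homeomorphism and its inverse cancel only on the underlying spaces, not on the whole types, so
  composites with them can be simplified only on an open neighbourhood of the point in question.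
\<close>

lemma locally_translates_cong:
  assumes "locally_translates X x f g" "openin X N" "x \<in> N"
    "\<And>y. y \<in> N \<Longrightarrow> f y = f' y" "\<And>y. y \<in> N \<Longrightarrow> g y = g' y"
  shows "locally_translates X x f' g'"
proof -
  obtain N' c where N: "openin X N'" "x \<in> N'" "\<And>y. y \<in> N' \<Longrightarrow> g y = f y + c"
    using assms(1) unfolding locally_translates_def by blast
  have "openin X (N \<inter> N')" "x \<in> N \<inter> N'" "\<forall>y\<in>N \<inter> N'. g' y = f' y + c"
    using N assms(2,3) by (auto simp flip: assms(4,5))
  then show ?thesis unfolding locally_translates_def by blast
qed

lemma chartD:
  assumes "translation_surface S" "(U, \<phi>) \<in> atlas S"
  shows "openin (surf_top S) U" "U \<inter> sing S = {}" "U \<subseteq> topspace (surf_top S)"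
  using assms openin_subset unfolding translation_surface_def translation_atlas_def by fastforce+

lemma charts_compatible:
  assumes "translation_surface S" "(U, \<phi>) \<in> atlas S" "(V, \<psi>) \<in> atlas S" "x \<in> U" "x \<in> V"
  shows "locally_translates (surf_top S) x \<phi> \<psi>"
  using assms unfolding translation_surface_def translation_atlas_def by fast

lemma obtain_chart:
  assumes "translation_surface S" "x \<in> topspace (surf_top S)" "x \<notin> sing S"
  obtains U \<phi> where "(U, \<phi>) \<in> atlas S" "x \<in> U"
proof -
  have "x \<in> \<Union> (fst ` atlas S)"
    using assms unfolding translation_surface_def translation_atlas_def by auto
  then show ?thesis using that by auto
qed

lemma same_surface_refl:
  assumes "translation_surface S"
  shows "S \<cong>\<^sub>t S"
  unfolding same_surface_def
proof (intro exI conjI)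
  show "homeomorphic_map (surf_top S) (surf_top S) id" by simp
  show "translation_in_charts S S id"
    unfolding translation_in_charts_def using charts_compatible[OF assms] by auto
qed simp

text \<open>
  Inverting a homeomorphism that is \<open>\<phi> \<mapsto> \<phi> + c\<close> in charts gives \<open>\<phi> \<mapsto> \<phi> - c\<close>. The condition
  at a point \<open>y\<close> of the target is the condition at its preimage, pulled back along the inverse.
\<close>

lemma same_surface_sym:
  assumes "translation_surface S" "translation_surface T" "S \<cong>\<^sub>t T"
  shows "T \<cong>\<^sub>t S"
proof -
  obtain f where f: "homeomorphic_map (surf_top S) (surf_top T) f" "f ` sing S = sing T"
    "translation_in_charts S T f"
    using assms(3) unfolding same_surface_def by blast
  obtain g where "homeomorphic_maps (surf_top S) (surf_top T) f g"
    using f(1) by (auto simp: homeomorphic_map_maps)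
  then have g: "homeomorphic_map (surf_top T) (surf_top S) g"
    and gf: "\<And>x. x \<in> topspace (surf_top S) \<Longrightarrow> g (f x) = x"
    and fg: "\<And>y. y \<in> topspace (surf_top T) \<Longrightarrow> f (g y) = y"
    by (auto simp: homeomorphic_maps_map)
  have "sing S \<subseteq> topspace (surf_top S)"
    using assms(1) by (simp add: translation_surface_def)
  then have "g ` sing T = sing S"
    using gf by (force simp: f(2)[symmetric] image_image)
  moreover have "translation_in_charts T S g"
    unfolding translation_in_charts_def
  proof (clarify)
    fix V \<psi> U \<phi> y
    assume V: "(V, \<psi>) \<in> atlas T" and U: "(U, \<phi>) \<in> atlas S" and y: "y \<in> V" "g y \<in> U"
    have yT: "y \<in> topspace (surf_top T)" using chartD[OF assms(2) V] y by auto
    have "locally_translates (surf_top S) (g y) \<phi> (\<psi> \<circ> f)"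
      using f(3) U V y fg[OF yT] unfolding translation_in_charts_def by fastforce
    then have "locally_translates (surf_top T) y (\<phi> \<circ> g) ((\<psi> \<circ> f) \<circ> g)"
      using homeomorphic_imp_continuous_map[OF g] yT by (intro locally_translates_pullback)
    then have "locally_translates (surf_top T) y ((\<psi> \<circ> f) \<circ> g) (\<phi> \<circ> g)"
      by (rule locally_translates_sym)
    then show "locally_translates (surf_top T) y \<psi> (\<phi> \<circ> g)"
      by (rule locally_translates_cong[OF _ openin_topspace yT]) (auto simp: fg)
  qed
  ultimately show ?thesis using g unfolding same_surface_def by blast
qed

text \<open>
  To compare charts at the two ends, a chart of the middle surface is needed around the image of
  the point. One exists because the first map, being injective and onto the singular set from the
  singular set, sends nonsingular points to nonsingular points.
\<close>

lemma same_surface_trans: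
  assumes "translation_surface S" "translation_surface T" "translation_surface R"
    and "S \<cong>\<^sub>t T" "T \<cong>\<^sub>t R"
  shows "S \<cong>\<^sub>t R"
proof -
  obtain f where f: "homeomorphic_map (surf_top S) (surf_top T) f" "f ` sing S = sing T"
    "translation_in_charts S T f"
    using assms(4) unfolding same_surface_def by blast
  obtain g where g: "homeomorphic_map (surf_top T) (surf_top R) g" "g ` sing T = sing R"
    "translation_in_charts T R g"
    using assms(5) unfolding same_surface_def by blast
  have "translation_in_charts S R (g \<circ> f)"
    unfolding translation_in_charts_def
  proof (clarify)
    fix U \<phi> W \<rho> x
    assume U: "(U, \<phi>) \<in> atlas S" and W: "(W, \<rho>) \<in> atlas R" and x: "x \<in> U" "(g \<circ> f) x \<in> W"
    have xS: "x \<in> topspace (surf_top S)" "x \<notin> sing S" using chartD[OF assms(1) U] x by auto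
    have fx: "f x \<in> topspace (surf_top T)"
      using f(1) xS by (auto simp: homeomorphic_eq_everything_map)
    have "inj_on f (topspace (surf_top S))" "sing S \<subseteq> topspace (surf_top S)"
      using f(1) assms(1) by (auto simp: homeomorphic_eq_everything_map translation_surface_def)
    then have "f x \<notin> sing T"
      using xS f(2) by (metis inj_on_image_mem_iff)
    then obtain V \<psi> where V: "(V, \<psi>) \<in> atlas T" "f x \<in> V"
      using obtain_chart[OF assms(2) fx] by blast
    have 1: "locally_translates (surf_top S) x \<phi> (\<psi> \<circ> f)"
      using f(3) U V x unfolding translation_in_charts_def by fastforce
    have "locally_translates (surf_top T) (f x) \<psi> (\<rho> \<circ> g)"
      using g(3) V W x unfolding translation_in_charts_def by fastforce
    then have "locally_translates (surf_top S) x (\<psi> \<circ> f) ((\<rho> \<circ> g) \<circ> f)"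
      using homeomorphic_imp_continuous_map[OF f(1)] xS by (intro locally_translates_pullback)
    with 1 show "locally_translates (surf_top S) x \<phi> (\<rho> \<circ> (g \<circ> f))"
      by (metis locally_translates_trans comp_assoc)
  qed
  moreover have "homeomorphic_map (surf_top S) (surf_top R) (g \<circ> f)"
    using f g by (blast intro: homeomorphic_map_compose)
  moreover have "(g \<circ> f) ` sing S = sing R" using f g by (metis image_comp)
  ultimately show ?thesis unfolding same_surface_def by blast
qed

lemma surface_class_eq_iff:
  assumes "translation_surface S" "translation_surface T"
  shows "surface_class S = surface_class T \<longleftrightarrow> S \<cong>\<^sub>t T"
proof
  assume "surface_class S = surface_class T"
  then show "S \<cong>\<^sub>t T"
    using same_surface_refl[OF assms(2)] assms unfolding surface_class_def by blast
next
  assume "S \<cong>\<^sub>t T"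
  then show "surface_class S = surface_class T"
    using assms same_surface_trans same_surface_sym unfolding surface_class_def by blast
qed

section \<open>The linear group acts on translation surfaces\<close>

lemma plane_act_add: "plane_act A (z + w) = plane_act A z + plane_act A w"
  by (simp add: plane_act_def complex_eq_iff algebra_simps)

lemma plane_act_mult: "plane_act (A ** B) z = plane_act A (plane_act B z)"
  by (simp add: plane_act_def matrix_matrix_mult_def sum_2 complex_eq_iff algebra_simps)

lemma plane_act_one [simp]: "plane_act (mat 1) z = z"
  by (simp add: plane_act_def mat_def complex_eq_iff)

text \<open>
  Real-linear maps of the plane have the form \<open>z \<mapsto> a z + b cnj z\<close>, with determinant
  \<open>\<bar>a\<bar>\<^sup>2 - \<bar>b\<bar>\<^sup>2\<close>. In these coordinates preservation of orientation says that the
  holomorphic part dominates, which is what makes a continuous choice of \<open>k\<close>-th root possible.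
\<close>

lemma plane_act_Wirtinger:
  assumes "det A = 1"
  obtains a b where "norm b < norm a" "\<And>z. plane_act A z = a * z + b * cnj z"
proof
  define a where "a = Complex ((A$1$1 + A$2$2) / 2) ((A$2$1 - A$1$2) / 2)"
  define b where "b = Complex ((A$1$1 - A$2$2) / 2) ((A$2$1 + A$1$2) / 2)"
  show "plane_act A z = a * z + b * cnj z" for z
    by (simp add: a_def b_def plane_act_def complex_eq_iff field_simps)
  have id: "((p + q) / 2)\<^sup>2 + ((r - s) / 2)\<^sup>2 - (((p - q) / 2)\<^sup>2 + ((r + s) / 2)\<^sup>2) = p * q - s * r"
    for p q r s :: real
    by (simp add: power_divide power2_sum power2_diff, simp add: field_simps)
  have "(norm a)\<^sup>2 - (norm b)\<^sup>2 = A$1$1 * A$2$2 - A$1$2 * A$2$1"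
    unfolding a_def b_def cmod_power2 complex.sel by (rule id)
  also have "\<dots> = 1" using assms by (simp only: det_2)
  finally have "(norm b)\<^sup>2 < (norm a)\<^sup>2" by linarith
  then show "norm b < norm a" by (rule power2_less_imp_less) simp
qed

text \<open>
  An orientation-preserving linear map \<open>L z = a z + b cnj z\<close> lifts through the branched covering
  \<open>w \<mapsto> w ^ k\<close>. Indeed \<open>L (w ^ k) = a w ^ k (1 + t w)\<close> with
  \<open>t w = (b / a) (cnj w / w) ^ k\<close> of modulus less than 1, so the last factor stays in the right
  half-plane, where the principal \<open>k\<close>-th root \<open>u\<close> is continuous. The lift is
  \<open>h w = \<alpha> w u(w)\<close> with \<open>\<alpha> ^ k = a\<close>. It is injective because \<open>h w = h v\<close> forces
  \<open>w ^ k = v ^ k\<close>, hence \<open>t w = t v\<close> and \<open>u w = u v\<close>, and then \<open>w = v\<close>.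
\<close>

lemma real_linear_lifts_to_power:
  fixes a b :: complex
  assumes "norm b < norm a" "k \<ge> 1"
  obtains h where "continuous_on UNIV h" "inj h" "h 0 = 0"
    "\<And>w. h w ^ k = a * w ^ k + b * cnj (w ^ k)"
proof
  define t where "t w = (b / a) * (cnj w / w) ^ k" for w
  define u where "u w = exp (Ln (1 + t w) / of_nat k)" for w
  define \<alpha> where "\<alpha> = exp (Ln a / of_nat k)"
  define h where "h w = \<alpha> * w * u w" for w
  have a0: "a \<noteq> 0" using assms by auto
  have \<alpha>0: "\<alpha> \<noteq> 0" by (simp add: \<alpha>_def)
  have \<alpha>k: "\<alpha> ^ k = a" using assms a0 by (simp add: \<alpha>_def exp_divide_power_eq)
  have t1: "norm (t w) < 1" for w
  proof -
    have "norm (cnj w / w) \<le> 1" by (simp add: norm_divide)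
    then have "norm (cnj w / w) ^ k \<le> 1" by (simp add: power_le_one)
    then have "norm (t w) \<le> norm (b / a)"
      unfolding t_def norm_mult norm_power by (rule mult_left_le) simp
    also have "\<dots> < 1" using assms a0 by (simp add: norm_divide)
    finally show ?thesis .
  qed
  have Re: "Re (1 + t w) > 0" for w
    using t1[of w] abs_Re_le_cmod[of "t w"] by simp
  then have nz: "1 + t w \<noteq> 0" for w by (metis less_irrefl zero_complex.sel(1))
  have uk: "u w ^ k = 1 + t w" for w
    using assms nz by (simp add: u_def exp_divide_power_eq)
  show hk: "h w ^ k = a * w ^ k + b * cnj (w ^ k)" for w
    using assms a0
    by (cases "w = 0") (auto simp: h_def power_mult_distrib \<alpha>k uk t_def power_0_left field_simps)
  show h0: "h 0 = 0" by (simp add: h_def)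
  show "inj h"
  proof (rule injI)
    fix w v assume eq: "h w = h v"
    (* The linear map itself is injective: a kernel element z would satisfy |a| |z| = |b| |z|. *)
    have "a * w ^ k + b * cnj (w ^ k) = a * v ^ k + b * cnj (v ^ k)"
      using hk eq by metis
    then have "a * (w ^ k - v ^ k) = - b * cnj (w ^ k - v ^ k)"
      by (simp add: algebra_simps)
    then have "norm a * norm (w ^ k - v ^ k) = norm b * norm (w ^ k - v ^ k)"
      by (metis norm_mult norm_minus_cancel complex_mod_cnj)
    then have wv: "w ^ k = v ^ k" using assms by auto
    then have "t w = t v"
      by (simp add: t_def power_divide flip: complex_cnj_power)
    then have "u w = u v" by (simp add: u_def)
    then show "w = v" using eq \<alpha>0 by (auto simp: h_def u_def)
  qed
  have "isCont h w" for w
  proof (cases "w = 0")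
    case False
    have "1 + t w \<notin> \<real>\<^sub>\<le>\<^sub>0" using Re[of w] by (auto simp: complex_nonpos_Reals_iff)
    with False show ?thesis
      unfolding h_def u_def using assms by (auto intro!: continuous_intros simp: t_def)
  next
    case True
    (* Away from 0 the value of t depends only on the direction of w, so t need not have a limit at 0, but
       the root u is bounded, which is enough for continuity of h there. *)
    have bound: "norm (h v) \<le> norm \<alpha> * 2 * norm v" for v
    proof -
      have "norm (u v) \<le> 2"
      proof (rule ccontr)
        assume "\<not> norm (u v) \<le> 2"
        then have "norm (u v) \<le> norm (u v) ^ k" using assms by (intro self_le_power) auto
        also have "\<dots> = norm (1 + t v)" by (metis norm_power uk)
        also have "\<dots> \<le> 2" using t1[of v] norm_triangle_ineq[of 1 "t v"] by simp
        finally show False using \<open>\<not> norm (u v) \<le> 2\<close> by simp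
      qed
      then have "norm \<alpha> * norm v * norm (u v) \<le> norm \<alpha> * norm v * 2"
        by (intro mult_left_mono) auto
      then show ?thesis by (simp add: h_def norm_mult algebra_simps)
    qed
    have "((\<lambda>v. norm \<alpha> * 2 * norm v) \<longlongrightarrow> 0) (at (0::complex))"
      by (auto intro!: tendsto_eq_intros)
    then have "(h \<longlongrightarrow> 0) (at 0)"
      by (rule Lim_null_comparison[rotated]) (simp add: bound)
    then show ?thesis using True h0 by (simp add: isCont_def)
  qed
  then show "continuous_on UNIV h" by (simp add: continuous_on_eq_continuous_at)
qed

text \<open>
  By invariance of domain, a coordinate map may be followed by any continuous injection of the
  plane into itself and remain a coordinate map. This serves both for charts, where the injection is
  linear, and for cone coordinates, where it is a lift through a power map.
\<close>

lemma homeomorphic_map_compose_injective: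
  fixes h :: "'a::euclidean_space \<Rightarrow> 'a"
  assumes h: "continuous_on UNIV h" "inj h"
    and f: "open (f ` U)" "homeomorphic_map X (top_of_set (f ` U)) f"
  shows "open ((h \<circ> f) ` U)" "homeomorphic_map X (top_of_set ((h \<circ> f) ` U)) (h \<circ> f)"
proof -
  have op: "open (h ` V)" if "open V" for V
    using h that by (metis invariance_of_domain continuous_on_subset inj_on_subset subset_UNIV)
  then show "open ((h \<circ> f) ` U)" using f by (metis image_comp)
  have "homeomorphic_map (top_of_set (f ` U)) (top_of_set (h ` f ` U)) h"
  proof (rule bijective_open_imp_homeomorphic_map)
    show "continuous_map (top_of_set (f ` U)) (top_of_set (h ` f ` U)) h"
      using h by (auto intro: continuous_on_subset)
    show "open_map (top_of_set (f ` U)) (top_of_set (h ` f ` U)) h"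
      using op f(1) by (auto simp: open_map_def openin_open_eq)
    show "inj_on h (topspace (top_of_set (f ` U)))"
      using h by (auto intro: inj_on_subset)
  qed auto
  then show "homeomorphic_map X (top_of_set ((h \<circ> f) ` U)) (h \<circ> f)"
    using f(2) by (metis homeomorphic_map_compose image_comp)
qed

lemma plane_act_continuous_inj:
  assumes "det A = 1"
  shows "continuous_on UNIV (plane_act A)" "inj (plane_act A)"
proof -
  obtain a b where ab: "norm b < norm a" "\<And>z. plane_act A z = a * z + b * cnj z"
    using plane_act_Wirtinger[OF assms] by blast
  show "continuous_on UNIV (plane_act A)"
    unfolding ab(2)[abs_def] by (intro continuous_intros)
  (* The case k = 1 of the lifting lemma returns the linear map itself, with its injectivity. *)
  obtain h where "inj h" "\<And>w. h w ^ 1 = a * w ^ 1 + b * cnj (w ^ 1)"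
    using real_linear_lifts_to_power[OF ab(1), of 1] by auto
  then have "h = plane_act A" using ab(2) by auto
  then show "inj (plane_act A)" using \<open>inj h\<close> by simp
qed

lemma locally_translates_plane_act:
  assumes "locally_translates X x f g"
  shows "locally_translates X x (plane_act A \<circ> f) (plane_act A \<circ> g)"
  using assms unfolding locally_translates_def by (metis comp_apply plane_act_add)

lemma surface_act_simps [simp]:
  "surf_top (A \<bullet>\<^sub>s S) = surf_top S" "sing (A \<bullet>\<^sub>s S) = sing S"
  "atlas (A \<bullet>\<^sub>s S) = (\<lambda>(U, \<phi>). (U, plane_act A \<circ> \<phi>)) ` atlas S"
  by (simp_all add: surface_act_def)

lemma surface_act_one [simp]: "mat 1 \<bullet>\<^sub>s S = S"
  by (simp add: surface_act_def comp_def)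

lemma surface_act_mult: "A \<bullet>\<^sub>s (B \<bullet>\<^sub>s S) = (A ** B) \<bullet>\<^sub>s S"
  by (auto simp: surface_act_def image_image case_prod_beta' comp_def plane_act_mult)

lemma surface_act_same_surface:
  assumes "S \<cong>\<^sub>t T"
  shows "A \<bullet>\<^sub>s S \<cong>\<^sub>t A \<bullet>\<^sub>s T"
proof -
  obtain f where f: "homeomorphic_map (surf_top S) (surf_top T) f" "f ` sing S = sing T"
    "translation_in_charts S T f"
    using assms unfolding same_surface_def by blast
  have "translation_in_charts (A \<bullet>\<^sub>s S) (A \<bullet>\<^sub>s T) f"
    unfolding translation_in_charts_def
  proof clarsimp
    fix U \<phi> V \<psi> x
    assume "(U, \<phi>) \<in> atlas S" "(V, \<psi>) \<in> atlas T" "x \<in> U" "f x \<in> V"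
    then have "locally_translates (surf_top S) x \<phi> (\<psi> \<circ> f)"
      using f(3) unfolding translation_in_charts_def by fastforce
    from locally_translates_plane_act[OF this]
    show "locally_translates (surf_top S) x (plane_act A \<circ> \<phi>) (plane_act A \<circ> \<psi> \<circ> f)"
      by (simp add: comp_assoc)
  qed
  with f show ?thesis unfolding same_surface_def by auto
qed

text \<open>
  If \<open>\<psi> ^ k\<close> is a translate of the old charts, then \<open>A (\<psi> ^ k)\<close> is a translate of the new
  ones. The new cone coordinate must be a \<open>k\<close>-th root of it, namely \<open>h \<circ> \<psi>\<close> for a lift \<open>h\<close>
  of \<open>A\<close> through the \<open>k\<close>-th power map; the cone angle is unchanged.
\<close>

lemma cone_point_surface_act:
  assumes "det A = 1" "cone_point S s"
  shows "cone_point (A \<bullet>\<^sub>s S) s"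
proof -
  obtain k U \<psi> where k: "k \<ge> 1" and U: "openin (surf_top S) U" "U \<inter> sing S = {s}"
    and \<psi>: "open (\<psi> ` U)" "homeomorphic_map (subtopology (surf_top S) U) (top_of_set (\<psi> ` U)) \<psi>"
      "\<psi> s = 0"
    and tr: "\<And>V \<phi> x. (V, \<phi>) \<in> atlas S \<Longrightarrow> x \<in> U \<inter> V \<Longrightarrow>
      locally_translates (surf_top S) x \<phi> (\<lambda>y. \<psi> y ^ (k::nat))"
    using assms(2) unfolding cone_point_def by fast
  obtain a b where ab: "norm b < norm a" "\<And>z. plane_act A z = a * z + b * cnj z"
    using plane_act_Wirtinger[OF assms(1)] by blast
  obtain h where h: "continuous_on UNIV h" "inj h" "h 0 = 0"
    "\<And>w. h w ^ k = a * w ^ k + b * cnj (w ^ k)"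
    using real_linear_lifts_to_power[OF ab(1) k] by blast
  have "locally_translates (surf_top S) x (plane_act A \<circ> \<phi>) (\<lambda>y. (h \<circ> \<psi>) y ^ k)"
    if "(V, \<phi>) \<in> atlas S" "x \<in> U \<inter> V" for V \<phi> x
    using locally_translates_plane_act[OF tr[OF that], of A] h(4) ab(2) by (simp add: comp_def)
  then show ?thesis
    unfolding cone_point_def
    using k U homeomorphic_map_compose_injective[OF h(1,2) \<psi>(1,2)] \<psi>(3) h(3)
    by (intro exI[of _ k] conjI exI[of _ U] exI[of _ "h \<circ> \<psi>"]) auto
qed

lemma translation_surface_act:
  assumes "det A = 1" "translation_surface S"
  shows "translation_surface (A \<bullet>\<^sub>s S)"
proof -
  have at: "translation_atlas S" using assms by (simp add: translation_surface_def)
  have "translation_atlas (A \<bullet>\<^sub>s S)"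
    unfolding translation_atlas_def
  proof (intro conjI)
    show "\<Union> (fst ` atlas (A \<bullet>\<^sub>s S)) = topspace (surf_top (A \<bullet>\<^sub>s S)) - sing (A \<bullet>\<^sub>s S)"
      using at by (simp add: translation_atlas_def image_image case_prod_beta')
    show "\<forall>(U, \<phi>)\<in>atlas (A \<bullet>\<^sub>s S). \<forall>(V, \<psi>)\<in>atlas (A \<bullet>\<^sub>s S). \<forall>x\<in>U \<inter> V.
        locally_translates (surf_top (A \<bullet>\<^sub>s S)) x \<phi> \<psi>"
      using charts_compatible[OF assms(2)] by (auto intro!: locally_translates_plane_act)
    show "\<forall>(U, \<phi>)\<in>atlas (A \<bullet>\<^sub>s S).
        openin (surf_top (A \<bullet>\<^sub>s S)) U \<and> U \<inter> sing (A \<bullet>\<^sub>s S) = {} \<and> open (\<phi> ` U) \<and>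
        homeomorphic_map (subtopology (surf_top (A \<bullet>\<^sub>s S)) U) (top_of_set (\<phi> ` U)) \<phi>"
    proof (clarsimp simp del: comp_apply)
      fix U \<phi> assume "(U, \<phi>) \<in> atlas S"
      then have "openin (surf_top S) U" "U \<inter> sing S = {}" and \<phi>: "open (\<phi> ` U)"
        "homeomorphic_map (subtopology (surf_top S) U) (top_of_set (\<phi> ` U)) \<phi>"
        using at unfolding translation_atlas_def by auto
      then show "openin (surf_top S) U \<and> U \<inter> sing S = {} \<and> open ((plane_act A \<circ> \<phi>) ` U) \<and>
          homeomorphic_map (subtopology (surf_top S) U)
            (top_of_set ((plane_act A \<circ> \<phi>) ` U)) (plane_act A \<circ> \<phi>)"
        using homeomorphic_map_compose_injective[OF plane_act_continuous_inj[OF assms(1)] \<phi>]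
        by blast
    qed
  qed
  then show ?thesis
    using assms unfolding translation_surface_def surface_act_simps
    by (blast intro: cone_point_surface_act)
qed

section \<open>The matrix group and its cosets\<close>

lemma SL2R_simps [simp]:
  "carrier SL2R = {A. det A = 1}" "A \<otimes>\<^bsub>SL2R\<^esub> B = A ** B" "\<one>\<^bsub>SL2R\<^esub> = mat 1"
  by (simp_all add: SL2R_def)

lemma group_SL2R: "group SL2R"
proof (rule groupI)
  fix A assume "A \<in> carrier SL2R"
  then have A: "det A = 1" by simp
  then obtain B where B: "B ** A = mat 1"
    by (metis invertible_det_nz invertible_def zero_neq_one)
  then have "det B * det A = 1" by (metis det_mul det_I)
  then show "\<exists>B\<in>carrier SL2R. B \<otimes>\<^bsub>SL2R\<^esub> A = \<one>\<^bsub>SL2R\<^esub>" using A B by auto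
qed (auto simp: det_mul matrix_mul_assoc)

interpretation SL2R: group SL2R by (rule group_SL2R)

lemma (in group) lcoset_eq_iff:
  assumes "subgroup H G" "a \<in> carrier G" "b \<in> carrier G"
  shows "a <# H = b <# H \<longleftrightarrow> inv a \<otimes> b \<in> H"
proof
  assume "a <# H = b <# H"
  then have "b \<in> a <# H" using lcos_self[OF assms(3,1)] by simp
  then show "inv a \<otimes> b \<in> H"
    by (rule subgroup.lcos_module_imp[OF assms(1) is_group assms(2)])
next
  assume "inv a \<otimes> b \<in> H"
  then have "b \<in> a <# H" by (rule subgroup.lcos_module_rev[OF assms(1) is_group assms(2,3)])
  then show "a <# H = b <# H" by (rule l_repr_independence[OF _ assms(2,1)])
qed

section \<open>Orbits and cosets\<close>

text \<open>
  \<open>V\<close> stands for the Veech group of the base surface: what is enumerated is the orbit of \<open>S\<close>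
  under a finitely generated group of matrices that contains the stabilizer of \<open>S\<close> with finite
  index.
\<close>

locale orbit_enumeration =
  fixes S :: "'a surface" and V :: "(real^2^2) set" and M :: "nat \<Rightarrow> real^2^2" and m :: nat
  assumes surface: "translation_surface S"
    and V_SL2R: "V \<subseteq> carrier SL2R"
    and veech_subgroup: "subgroup (veech S) (SL2R\<lparr>carrier := V\<rparr>)"
    and finite_index: "finite (lcosets\<^bsub>SL2R\<lparr>carrier := V\<rparr>\<^esub> (veech S))"
    and generators: "generate SL2R (M ` {1..m}) = V"
begin

abbreviation G where "G \<equiv> SL2R\<lparr>carrier := V\<rparr>"

lemma generator_in_V: "j \<in> {1..m} \<Longrightarrow> M j \<in> V"
  unfolding generators[symmetric] by (intro generate.incl imageI)

lemma subgroup_V: "subgroup V SL2R"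
proof -
  have "M ` {1..m} \<subseteq> carrier SL2R" using generator_in_V V_SL2R by blast
  then show ?thesis using SL2R.generate_is_subgroup generators by metis
qed

sublocale G: group G
  by (rule subgroup.subgroup_is_group[OF subgroup_V group_SL2R])

lemma V_mult: "A \<in> V \<Longrightarrow> B \<in> V \<Longrightarrow> A ** B \<in> V"
  using G.m_closed[of A B] by simp

lemma V_one: "mat 1 \<in> V"
  using G.one_closed by simp

lemma V_det: "A \<in> V \<Longrightarrow> det A = 1"
  using V_SL2R by auto

lemma V_inverse:
  assumes "A \<in> V"
  shows "inv\<^bsub>SL2R\<^esub> A \<in> V" "inv\<^bsub>SL2R\<^esub> A ** A = mat 1" "A ** inv\<^bsub>SL2R\<^esub> A = mat 1"
  using assms subgroup.m_inv_closed[OF subgroup_V] SL2R.l_inv[of A] SL2R.r_inv[of A] V_det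
  by auto

lemma act_surface: "A \<in> V \<Longrightarrow> translation_surface T \<Longrightarrow> translation_surface (A \<bullet>\<^sub>s T)"
  by (simp add: V_det translation_surface_act)

lemma inverse_act_left:
  assumes "A \<in> V" "T \<cong>\<^sub>t A \<bullet>\<^sub>s R"
  shows "inv\<^bsub>SL2R\<^esub> A \<bullet>\<^sub>s T \<cong>\<^sub>t R"
  using surface_act_same_surface[OF assms(2), of "inv\<^bsub>SL2R\<^esub> A"] V_inverse(2)[OF assms(1)]
  by (simp add: surface_act_mult)

text \<open>
  The orbit-stabilizer correspondence: \<open>A(S) = B(S)\<close> says that \<open>A\<^sup>-\<^sup>1 B\<close> fixes \<open>S\<close>, that is,
  that \<open>A\<^sup>-\<^sup>1 B\<close> lies in the stabilizer \<open>V(S)\<close>.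
\<close>

lemma orbit_eq_iff_lcoset_eq:
  assumes "A \<in> V" "B \<in> V"
  shows "A \<bullet>\<^sub>s S \<cong>\<^sub>t B \<bullet>\<^sub>s S \<longleftrightarrow> A <#\<^bsub>G\<^esub> veech S = B <#\<^bsub>G\<^esub> veech S"
proof -
  let ?A' = "inv\<^bsub>SL2R\<^esub> A"
  have "?A' ** B \<in> V" using assms V_inverse V_mult by blast
  have "A \<bullet>\<^sub>s S \<cong>\<^sub>t B \<bullet>\<^sub>s S \<longleftrightarrow> B \<bullet>\<^sub>s S \<cong>\<^sub>t A \<bullet>\<^sub>s S"
    using assms act_surface surface same_surface_sym by blast
  also have "\<dots> \<longleftrightarrow> (?A' ** B) \<bullet>\<^sub>s S \<cong>\<^sub>t S"
  proof
    assume "B \<bullet>\<^sub>s S \<cong>\<^sub>t A \<bullet>\<^sub>s S"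
    from inverse_act_left[OF assms(1) this] show "(?A' ** B) \<bullet>\<^sub>s S \<cong>\<^sub>t S"
      by (simp add: surface_act_mult)
  next
    assume "(?A' ** B) \<bullet>\<^sub>s S \<cong>\<^sub>t S"
    then have "A \<bullet>\<^sub>s ((?A' ** B) \<bullet>\<^sub>s S) \<cong>\<^sub>t A \<bullet>\<^sub>s S" by (rule surface_act_same_surface)
    then show "B \<bullet>\<^sub>s S \<cong>\<^sub>t A \<bullet>\<^sub>s S"
      using V_inverse(3)[OF assms(1)] by (simp add: surface_act_mult matrix_mul_assoc)
  qed
  also have "\<dots> \<longleftrightarrow> ?A' ** B \<in> veech S"
    using \<open>?A' ** B \<in> V\<close> V_det by (simp add: veech_def)
  also have "\<dots> \<longleftrightarrow> inv\<^bsub>G\<^esub> A \<otimes>\<^bsub>G\<^esub> B \<in> veech S"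
    using assms SL2R.m_inv_consistent[OF subgroup_V] by simp
  also have "\<dots> \<longleftrightarrow> A <#\<^bsub>G\<^esub> veech S = B <#\<^bsub>G\<^esub> veech S"
    using G.lcoset_eq_iff[OF veech_subgroup, of A B] assms by simp
  finally show ?thesis .
qed

lemma word_matrix_Nil [simp]: "word_matrix M [] = mat 1"
  and word_matrix_Cons [simp]: "word_matrix M (j # w) = M j ** word_matrix M w"
  by (simp_all add: word_matrix_def)

lemma word_matrix_in_V: "set w \<subseteq> {1..m} \<Longrightarrow> word_matrix M w \<in> V"
  by (induction w) (use V_one V_mult generator_in_V in auto)

section \<open>The loop invariant\<close>

text \<open>
  The listed surfaces are not merely equal to \<open>C\<^sub>i(S)\<close> as translation surfaces, they are literally
  the records \<open>C\<^sub>i \<bullet>\<^sub>s S\<close>, since a new one is always produced by applying a generator to a listed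
  one.
\<close>

definition distinct_translates ::
    "nat \<Rightarrow> (nat \<Rightarrow> 'a surface) \<Rightarrow> (nat \<Rightarrow> nat list) \<Rightarrow> bool" where
  "distinct_translates n T W \<longleftrightarrow>
     1 \<le> n \<and> T 1 = S \<and> W 1 = [] \<and>
     (\<forall>i\<in>{1..n}. set (W i) \<subseteq> {1..m} \<and> T i = word_matrix M (W i) \<bullet>\<^sub>s S) \<and>
     (\<forall>i\<in>{1..n}. \<forall>k\<in>{1..n}. T i \<cong>\<^sub>t T k \<longrightarrow> i = k)"

text \<open>
  Which entries are present is recorded separately, in the invariant below.
\<close>

definition dict_sound :: "nat \<Rightarrow> (nat \<Rightarrow> 'a surface) \<Rightarrow> (nat \<Rightarrow> nat \<rightharpoonup> nat) \<Rightarrow> bool" where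
  "dict_sound n T d \<longleftrightarrow>
     (\<forall>j\<in>{1..m}. \<forall>i k. d j i = Some k \<longrightarrow> k \<in> {1..n} \<and> M j \<bullet>\<^sub>s T i \<cong>\<^sub>t T k)"

text \<open>
  An index has a complete set of dictionary entries once it has left \<open>nf\<close> and its inner loop is
  over. The entry of the current index is missing exactly for the generators still in \<open>todo\<close>;
  this is what makes the dictionaries total when the algorithm halts.
\<close>

definition invariant :: "'a alg_state \<Rightarrow> bool" where
  "invariant s \<longleftrightarrow>
     distinct_translates (num s) (surf s) (word s) \<and> dict_sound (num s) (surf s) (dict s) \<and>
     nf s \<subseteq> {1..num s} \<and> todo s \<subseteq> {1..m} \<and> (todo s \<noteq> {} \<longrightarrow> cur s \<in> {1..num s} - nf s) \<and>
     (\<forall>j\<in>{1..m}. dom (dict s j) = {1..num s} - nf s - (if j \<in> todo s then {cur s} else {}))"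

lemma invariantD:
  assumes "invariant s"
  shows "1 \<le> num s" "surf s 1 = S" "word s 1 = []"
    and "\<And>i. i \<in> {1..num s} \<Longrightarrow> set (word s i) \<subseteq> {1..m}"
    and "\<And>i. i \<in> {1..num s} \<Longrightarrow> surf s i = word_matrix M (word s i) \<bullet>\<^sub>s S"
    and "\<And>i k. i \<in> {1..num s} \<Longrightarrow> k \<in> {1..num s} \<Longrightarrow> surf s i \<cong>\<^sub>t surf s k \<Longrightarrow> i = k"
    and "nf s \<subseteq> {1..num s}" "todo s \<subseteq> {1..m}" "todo s \<noteq> {} \<Longrightarrow> cur s \<in> {1..num s} - nf s"
    and "\<And>j. j \<in> {1..m} \<Longrightarrow>
      dom (dict s j) = {1..num s} - nf s - (if j \<in> todo s then {cur s} else {})"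
    and "\<And>j i k. j \<in> {1..m} \<Longrightarrow> dict s j i = Some k \<Longrightarrow> k \<in> {1..num s}"
    and "\<And>j i k. j \<in> {1..m} \<Longrightarrow> dict s j i = Some k \<Longrightarrow> M j \<bullet>\<^sub>s surf s i \<cong>\<^sub>t surf s k"
  using assms unfolding invariant_def distinct_translates_def dict_sound_def by blast+

lemma invariant_surface:
  assumes "invariant s" "i \<in> {1..num s}"
  shows "word_matrix M (word s i) \<in> V" "translation_surface (surf s i)"
proof -
  show "word_matrix M (word s i) \<in> V" using word_matrix_in_V[OF invariantD(4)[OF assms]] .
  from act_surface[OF this surface] show "translation_surface (surf s i)"
    by (simp add: invariantD(5)[OF assms])
qed

lemma invariant_init: "invariant (alg_init S)"
  by (auto simp: invariant_def distinct_translates_def dict_sound_def alg_init_def)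

text \<open>
  When a surface is appended, the distinctness of the list relies on the symmetry of \<open>\<cong>\<^sub>t\<close>, since
  the algorithm compares the new surface with the old ones in one direction.
\<close>

lemma invariant_step:
  assumes "alg_step M m s s'" "invariant s"
  shows "invariant s'"
  using assms
proof (induction rule: alg_step.induct)
  case (pick s i)
  note I = invariantD[OF pick(3)]
  have "dom (dict s j) = {1..num s} - (nf s - {i}) - {i}" if "j \<in> {1..m}" for j
    using I(10)[OF that] pick(1,2) by auto
  moreover have "i \<in> {1..num s}" "nf s - {i} \<subseteq> {1..num s}" using I(7) pick(2) by auto
  ultimately show ?case
    using pick(3) unfolding invariant_def by simp
next
  case (found j s k)
  note I = invariantD[OF found(4)]
  have c: "cur s \<in> {1..num s}" "cur s \<notin> nf s" using I(9) found(1) by auto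
  let ?d = "(dict s)(j := (dict s j)(cur s \<mapsto> k))"
  have "dom (?d j') = {1..num s} - nf s - (if j' \<in> todo s - {j} then {cur s} else {})"
    if "j' \<in> {1..m}" for j'
    using I(10)[OF that] c found(1) by auto
  moreover have "dict_sound (num s) (surf s) ?d"
    unfolding dict_sound_def
  proof (intro ballI allI impI)
    fix j' i k' assume "j' \<in> {1..m}" "?d j' i = Some k'"
    then show "k' \<in> {1..num s} \<and> M j' \<bullet>\<^sub>s surf s i \<cong>\<^sub>t surf s k'"
      using I(11,12)[of j' i k'] found(2,3) by (auto split: if_splits)
  qed
  moreover have "todo s - {j} \<subseteq> {1..m}" "cur s \<in> {1..num s} - nf s" using I(8) c by auto
  ultimately show ?case
    using found(4) unfolding invariant_def by simp
next
  case (new j s n')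
  note I = invariantD[OF new(4)]
  have j: "j \<in> {1..m}" using I(8) new(1) by blast
  have c: "cur s \<in> {1..num s}" "cur s \<notin> nf s" using I(9) new(1) by auto
  have n': "n' \<notin> {1..num s}" "{1..n'} = insert n' {1..num s}" using new(3) by auto
  let ?T = "M j \<bullet>\<^sub>s surf s (cur s)"
  let ?s = "(surf s)(n' := ?T)" and ?w = "(word s)(n' := j # word s (cur s))"
  let ?d = "(dict s)(j := (dict s j)(cur s \<mapsto> n'))"
  have T: "translation_surface ?T"
    using invariant_surface[OF new(4) c(1)] generator_in_V[OF j] act_surface by blast
  have old: "\<not> ?T \<cong>\<^sub>t surf s k" "\<not> surf s k \<cong>\<^sub>t ?T" if "k \<in> {1..num s}" for k
    using new(2) that same_surface_sym[OF invariant_surface(2)[OF new(4) that] T] by blast+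
  have "distinct_translates n' ?s ?w"
    unfolding distinct_translates_def
  proof (intro conjI ballI impI)
    show "1 \<le> n'" "?s 1 = S" "?w 1 = []" using I(1-3) new(3) by auto
    show "set (?w i) \<subseteq> {1..m}" if "i \<in> {1..n'}" for i
      using that I(4)[of i] I(4)[OF c(1)] j n' by (cases "i = n'") (simp_all add: new(3))
    show "?s i = word_matrix M (?w i) \<bullet>\<^sub>s S" if "i \<in> {1..n'}" for i
      using that I(5)[of i] I(5)[OF c(1)] n' by (cases "i = n'") (auto simp: surface_act_mult)
    show "i = k" if "i \<in> {1..n'}" "k \<in> {1..n'}" "?s i \<cong>\<^sub>t ?s k" for i k
      using that I(6)[of i k] old[of i] old[of k] n' by (cases "i = n'"; cases "k = n'") auto
  qed
  moreover have "dom (?d j') =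
      {1..n'} - insert n' (nf s) - (if j' \<in> todo s - {j} then {cur s} else {})"
    if "j' \<in> {1..m}" for j'
  proof -
    have "{1..n'} - insert n' (nf s) = {1..num s} - nf s" using n' by auto
    then show ?thesis using I(10)[OF that] c new(1) by auto
  qed
  moreover have "dict_sound n' ?s ?d"
    unfolding dict_sound_def
  proof (intro ballI allI impI)
    fix j' i k assume j': "j' \<in> {1..m}" and d: "?d j' i = Some k"
    show "k \<in> {1..n'} \<and> M j' \<bullet>\<^sub>s ?s i \<cong>\<^sub>t ?s k"
    proof (cases "j' = j \<and> i = cur s")
      case True
      then have "k = n'" using d by simp
      then show ?thesis using True c n' same_surface_refl[OF T] by auto
    next
      case False
      then have d': "dict s j' i = Some k" using d by (auto split: if_splits)
      then have "i \<in> dom (dict s j')" by blast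
      then have "i \<in> {1..num s}" using I(10)[OF j'] by blast
      then have "i \<noteq> n'" using n' by blast
      moreover have "k \<in> {1..n'}" "k \<noteq> n'" using I(11)[OF j' d'] n' by auto
      ultimately show ?thesis using I(12)[OF j' d'] by simp
    qed
  qed
  moreover have "insert n' (nf s) \<subseteq> {1..n'}" "todo s - {j} \<subseteq> {1..m}"
    "cur s \<in> {1..n'} - insert n' (nf s)"
    using I(7,8) n' c by auto
  ultimately show ?case unfolding invariant_def by simp
qed

lemma invariant_reachable: "alg_reachable M m S s \<Longrightarrow> invariant s"
  unfolding alg_reachable_def
  by (induction rule: rtranclp_induct) (auto intro: invariant_init invariant_step)

section \<open>Termination\<close>

text \<open>
  Distinct surfaces in the orbit lie over distinct cosets, so the list can never be longer than the
  index of \<open>V(S)\<close>.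
\<close>

lemma invariant_lcosets:
  assumes "invariant s"
  shows "inj_on (\<lambda>i. word_matrix M (word s i) <#\<^bsub>G\<^esub> veech S) {1..num s}"
    and "(\<lambda>i. word_matrix M (word s i) <#\<^bsub>G\<^esub> veech S) ` {1..num s} \<subseteq> lcosets\<^bsub>G\<^esub> (veech S)"
proof -
  show "inj_on (\<lambda>i. word_matrix M (word s i) <#\<^bsub>G\<^esub> veech S) {1..num s}"
  proof (rule inj_onI)
    fix i k
    assume i: "i \<in> {1..num s}" and k: "k \<in> {1..num s}"
      and "word_matrix M (word s i) <#\<^bsub>G\<^esub> veech S = word_matrix M (word s k) <#\<^bsub>G\<^esub> veech S"
    then have "surf s i \<cong>\<^sub>t surf s k"
      using orbit_eq_iff_lcoset_eq invariant_surface(1)[OF assms] invariantD(5)[OF assms] by simp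
    then show "i = k" using invariantD(6)[OF assms i k] by blast
  qed
  show "(\<lambda>i. word_matrix M (word s i) <#\<^bsub>G\<^esub> veech S) ` {1..num s} \<subseteq> lcosets\<^bsub>G\<^esub> (veech S)"
  proof (rule image_subsetI)
    fix i assume "i \<in> {1..num s}"
    then have "word_matrix M (word s i) \<in> carrier G" using invariant_surface(1)[OF assms] by simp
    then show "word_matrix M (word s i) <#\<^bsub>G\<^esub> veech S \<in> lcosets\<^bsub>G\<^esub> (veech S)"
      unfolding LCOSETS_def by blast
  qed
qed

lemma invariant_num_le: "invariant s \<Longrightarrow> num s \<le> card (lcosets\<^bsub>G\<^esub> (veech S))"
  using card_inj_on_le[OF invariant_lcosets finite_index] by simp

text \<open>
  Each listed surface is processed once, at the cost of one selection and \<open>m\<close> executions of the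
  inner body. The surfaces still to be processed are those in \<open>nf\<close> and at most
  \<open>[V : V(S)] - num s\<close> others that have not been found yet; by \<open>invariant_num_le\<close> this
  difference of natural numbers is never truncated. A discovery moves one surface from the second
  group to the first, so the first factor does not change and \<open>todo\<close> shrinks. A selection lowers
  that factor by 1 and so gains \<open>m + 1\<close>, more than the \<open>m\<close> new elements of \<open>todo\<close>.
\<close>

definition remaining_work :: "'a alg_state \<Rightarrow> nat" where
  "remaining_work s =
     (card (lcosets\<^bsub>G\<^esub> (veech S)) - num s + card (nf s)) * (m + 1) + card (todo s)"

lemma remaining_work_decreases:
  assumes "alg_step M m s s'" "invariant s"
  shows "remaining_work s' < remaining_work s"
proof -
  let ?N = "card (lcosets\<^bsub>G\<^esub> (veech S))"
  have I: "invariant s'" using invariant_step assms by blast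
  have fin: "finite (nf s)" "finite (todo s)"
    using invariantD(7,8)[OF assms(2)] finite_subset by blast+
  have del: "card (todo s - {j}) < card (todo s)" if "j \<in> todo s" for j
    by (rule card_Diff1_less[OF fin(2) that])
  show ?thesis
    using assms(1)
  proof cases
    case (pick i)
    then obtain c where "card (nf s) = Suc c" "card (nf s - {i}) = c"
      using fin by (metis card_Suc_Diff1)
    then show ?thesis using pick by (simp add: remaining_work_def)
  next
    case (found j k)
    then show ?thesis using del by (simp add: remaining_work_def)
  next
    case (new j n')
    have "n' \<notin> nf s" using invariantD(7)[OF assms(2)] new by auto
    moreover have "num s + 1 \<le> ?N" using invariant_num_le[OF I] new by simp
    ultimately have "?N - n' + card (insert n' (nf s)) = ?N - num s + card (nf s)"
      using fin new by simp
    then show ?thesis using del new by (simp add: remaining_work_def)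
  qed
qed

lemma terminates: "alg_terminates M m S"
  unfolding alg_terminates_def
proof (intro conjI notI allI impI)
  assume "\<exists>r. r 0 = alg_init S \<and> (\<forall>t::nat. alg_step M m (r t) (r (Suc t)))"
  then obtain r where r: "r 0 = alg_init S" "\<And>t::nat. alg_step M m (r t) (r (Suc t))" by blast
  have "invariant (r t)" for t
    by (induction t) (use r invariant_init invariant_step in auto)
  then have "(r (Suc t), r t) \<in> Wellfounded.measure remaining_work" for t
    using r(2) remaining_work_decreases by simp
  then show False
    using wf_iff_no_infinite_down_chain[of "Wellfounded.measure remaining_work"] by blast
next
  fix s assume s: "alg_reachable M m S s \<and> (\<nexists>s'. alg_step M m s s')"
  have "todo s = {}"
    using s alg_step.found[of _ s _ M m] alg_step.new[of _ s M "num s + 1" m] by blast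
  moreover from this have "nf s = {}" using s alg_step.pick[of s _ M m] by blast
  ultimately show "alg_halted s" by (simp add: alg_halted_def)
qed

section \<open>The output enumerates the orbit and the cosets\<close>

text \<open>
  At the end every dictionary is a total self-map of the finite index set. It is injective because
  \<open>M\<^sub>j(S\<^sub>i) = M\<^sub>j(S\<^sub>k)\<close> implies \<open>S\<^sub>i = S\<^sub>k\<close>, hence it is a permutation.
\<close>

lemma halted_dict:
  assumes s: "invariant s" "alg_halted s" and j: "j \<in> {1..m}"
  shows "dom (dict s j) = {1..num s}"
    and "\<And>i. i \<in> {1..num s} \<Longrightarrow> M j \<bullet>\<^sub>s surf s i \<cong>\<^sub>t surf s (the (dict s j i))"
    and "bij_betw (\<lambda>i. the (dict s j i)) {1..num s} {1..num s}"
proof -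
  let ?d = "\<lambda>i. the (dict s j i)"
  show dom: "dom (dict s j) = {1..num s}"
    using invariantD(10)[OF s(1) j] s(2) by (simp add: alg_halted_def)
  have Some: "dict s j i = Some (?d i)" if "i \<in> {1..num s}" for i
    using that dom by (metis domD option.sel)
  show step: "M j \<bullet>\<^sub>s surf s i \<cong>\<^sub>t surf s (?d i)" if "i \<in> {1..num s}" for i
    using invariantD(12)[OF s(1) j Some[OF that]] .
  have range: "?d i \<in> {1..num s}" if "i \<in> {1..num s}" for i
    using invariantD(11)[OF s(1) j Some[OF that]] .
  have "inj_on ?d {1..num s}"
  proof (rule inj_onI)
    fix i k assume i: "i \<in> {1..num s}" and k: "k \<in> {1..num s}" and eq: "?d i = ?d k"
    note tr = invariant_surface(2)[OF s(1)]
    note act = act_surface[OF generator_in_V[OF j]]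
    have "surf s (?d i) \<cong>\<^sub>t M j \<bullet>\<^sub>s surf s k"
      using step[OF k] same_surface_sym[OF act[OF tr[OF k]] tr[OF range[OF k]]] eq by simp
    then have "M j \<bullet>\<^sub>s surf s i \<cong>\<^sub>t M j \<bullet>\<^sub>s surf s k"
      using step[OF i] same_surface_trans[OF act[OF tr[OF i]] tr[OF range[OF i]] act[OF tr[OF k]]]
      by blast
    then have "surf s i \<cong>\<^sub>t surf s k"
      using inverse_act_left[OF generator_in_V[OF j]] V_inverse(2)[OF generator_in_V[OF j]]
      by (fastforce simp: surface_act_mult)
    then show "i = k" using invariantD(6)[OF s(1) i k] by blast
  qed
  moreover from this have "?d ` {1..num s} = {1..num s}"
    using range by (intro endo_inj_surj) auto
  ultimately show "bij_betw ?d {1..num s} {1..num s}" by (simp add: bij_betw_def)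
qed

text \<open>
  The list is closed under the generators by totality of the dictionaries. It is closed under their
  inverses, which the algorithm never applies, because the dictionaries are surjective:
  \<open>M\<^sub>j\<^sup>-\<^sup>1(S\<^sub>i)\<close> is \<open>S\<^sub>k\<close> for the index \<open>k\<close> that \<open>m\<^sub>j\<close> sends to \<open>i\<close>.
\<close>

lemma halted_orbit_closed:
  assumes s: "invariant s" "alg_halted s" and "A \<in> V" "i \<in> {1..num s}"
  shows "\<exists>k\<in>{1..num s}. A \<bullet>\<^sub>s surf s i \<cong>\<^sub>t surf s k"
proof -
  note tr = invariant_surface(2)[OF s(1)]
  have "A \<in> generate SL2R (M ` {1..m})" using assms(3) generators by simp
  then show ?thesis using assms(4)
  proof (induction arbitrary: i rule: generate.induct)
    case one
    then show ?case using same_surface_refl[OF tr] by (intro bexI[of _ i]) auto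
  next
    case (incl h)
    then obtain j where "j \<in> {1..m}" "h = M j" by auto
    then show ?case
      using halted_dict[OF s] incl(2) by (metis bij_betw_apply)
  next
    case (inv h)
    then obtain j where j: "j \<in> {1..m}" "h = M j" by auto
    have "i \<in> (\<lambda>i. the (dict s j i)) ` {1..num s}"
      unfolding bij_betw_imp_surj_on[OF halted_dict(3)[OF s j(1)]] by (rule inv(2))
    then obtain k where k: "i = the (dict s j k)" "k \<in> {1..num s}" by (rule imageE)
    have h: "h \<in> V" using generator_in_V j by simp
    have "h \<bullet>\<^sub>s surf s k \<cong>\<^sub>t surf s i"
      using halted_dict(2)[OF s j(1) k(2)] k(1) j(2) by simp
    then have "surf s i \<cong>\<^sub>t h \<bullet>\<^sub>s surf s k"
      by (rule same_surface_sym[OF act_surface[OF h tr[OF k(2)]] tr[OF inv(2)]])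
    then show ?case using inverse_act_left[OF h] k(2) by blast
  next
    case (eng h1 h2)
    then have h: "h1 \<in> V" "h2 \<in> V" using generators by auto
    obtain l where l: "l \<in> {1..num s}" "h2 \<bullet>\<^sub>s surf s i \<cong>\<^sub>t surf s l"
      using eng by blast
    obtain k where k: "k \<in> {1..num s}" "h1 \<bullet>\<^sub>s surf s l \<cong>\<^sub>t surf s k"
      using eng l by blast
    have "h1 \<bullet>\<^sub>s (h2 \<bullet>\<^sub>s surf s i) \<cong>\<^sub>t h1 \<bullet>\<^sub>s surf s l"
      using l surface_act_same_surface by blast
    then have "h1 \<bullet>\<^sub>s (h2 \<bullet>\<^sub>s surf s i) \<cong>\<^sub>t surf s k"
      using k h l eng.prems by (meson same_surface_trans act_surface tr)
    then show ?case using k by (auto simp: surface_act_mult)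
  qed
qed

lemma halted_exhausts:
  assumes s: "invariant s" "alg_halted s" and A: "A \<in> V"
  obtains i where "i \<in> {1..num s}" "A \<bullet>\<^sub>s S \<cong>\<^sub>t surf s i"
    "A <#\<^bsub>G\<^esub> veech S = word_matrix M (word s i) <#\<^bsub>G\<^esub> veech S"
proof -
  have "1 \<in> {1..num s}" using invariantD(1)[OF s(1)] by simp
  then obtain i where i: "i \<in> {1..num s}" "A \<bullet>\<^sub>s S \<cong>\<^sub>t surf s i"
    using halted_orbit_closed[OF s A] invariantD(2)[OF s(1)] by metis
  moreover from this have "A <#\<^bsub>G\<^esub> veech S = word_matrix M (word s i) <#\<^bsub>G\<^esub> veech S"
    using orbit_eq_iff_lcoset_eq[OF A invariant_surface(1)[OF s(1) i(1)]]
      invariantD(5)[OF s(1) i(1)] by simp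
  ultimately show ?thesis using that by blast
qed

lemma halted_lcosets:
  assumes s: "invariant s" "alg_halted s"
  shows "bij_betw (\<lambda>i. word_matrix M (word s i) <#\<^bsub>G\<^esub> veech S) {1..num s}
           (lcosets\<^bsub>G\<^esub> (veech S))"
proof -
  let ?c = "\<lambda>i. word_matrix M (word s i) <#\<^bsub>G\<^esub> veech S"
  have "lcosets\<^bsub>G\<^esub> (veech S) \<subseteq> ?c ` {1..num s}"
  proof
    fix X assume "X \<in> lcosets\<^bsub>G\<^esub> (veech S)"
    then obtain A where "A \<in> V" "X = A <#\<^bsub>G\<^esub> veech S" by (auto simp: LCOSETS_def)
    then show "X \<in> ?c ` {1..num s}" using halted_exhausts[OF s] by blast
  qed
  then show ?thesis using invariant_lcosets[OF s(1)] unfolding bij_betw_def by blast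
qed

lemma halted_orbit:
  assumes s: "invariant s" "alg_halted s"
  shows "bij_betw (\<lambda>i. surface_class (surf s i)) {1..num s}
           ((\<lambda>A. surface_class (A \<bullet>\<^sub>s S)) ` V)"
  unfolding bij_betw_def
proof
  note tr = invariant_surface[OF s(1)]
  show "inj_on (\<lambda>i. surface_class (surf s i)) {1..num s}"
    using invariantD(6)[OF s(1)] surface_class_eq_iff tr(2) by (intro inj_onI) blast
  have "surface_class (surf s i) \<in> (\<lambda>A. surface_class (A \<bullet>\<^sub>s S)) ` V" if "i \<in> {1..num s}" for i
    using tr(1)[OF that] invariantD(5)[OF s(1) that] by simp
  moreover have "surface_class (A \<bullet>\<^sub>s S) \<in> (\<lambda>i. surface_class (surf s i)) ` {1..num s}"
    if A: "A \<in> V" for A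
  proof -
    obtain i where i: "i \<in> {1..num s}" "A \<bullet>\<^sub>s S \<cong>\<^sub>t surf s i"
      using halted_exhausts[OF s A] by blast
    then have "surface_class (A \<bullet>\<^sub>s S) = surface_class (surf s i)"
      using surface_class_eq_iff[OF act_surface[OF A surface] tr(2)] by blast
    with i show ?thesis by blast
  qed
  ultimately show "(\<lambda>i. surface_class (surf s i)) ` {1..num s} =
      (\<lambda>A. surface_class (A \<bullet>\<^sub>s S)) ` V"
    by blast
qed

lemma halted_dict_lcoset:
  assumes s: "invariant s" "alg_halted s" and j: "j \<in> {1..m}" and i: "i \<in> {1..num s}"
  shows "(M j ** word_matrix M (word s i)) <#\<^bsub>G\<^esub> veech S =
    word_matrix M (word s (the (dict s j i))) <#\<^bsub>G\<^esub> veech S"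
proof -
  let ?k = "the (dict s j i)"
  have k: "?k \<in> {1..num s}" using halted_dict(3)[OF s j] i bij_betw_apply by fastforce
  have "(M j ** word_matrix M (word s i)) \<bullet>\<^sub>s S \<cong>\<^sub>t word_matrix M (word s ?k) \<bullet>\<^sub>s S"
    using halted_dict(2)[OF s j i] invariantD(5)[OF s(1) i] invariantD(5)[OF s(1) k]
    by (simp add: surface_act_mult)
  then show ?thesis
    using orbit_eq_iff_lcoset_eq V_mult[OF generator_in_V[OF j]] invariant_surface(1)[OF s(1)] i k
    by blast
qed

end

theorem proposition8p3:
  fixes S :: "'a surface" and P :: "'b surface" and p :: "'a \<Rightarrow> 'b"
    and M :: "nat \<Rightarrow> real^2^2" and m :: nat
  assumes "translation_surface S" and "translation_surface P"
    and "branched_covering S P p"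
    and H0: "subgroup (veech S) (veech_group P)"
    and H1: "finite (lcosets\<^bsub>veech_group P\<^esub> (veech S))"
    and H2: "generate SL2R (M ` {1..m}) = veech P"
  shows "alg_terminates M m S \<and>
    (\<forall>n W T d. alg_output M m S n W T d \<longrightarrow>
      (let C = (\<lambda>i. word_matrix M (W i)) in
        \<comment> \<open>the type of the output\<close>
        (\<forall>i\<in>{1..n}. set (W i) \<subseteq> {1..m} \<and> C i \<in> veech P \<and> translation_surface (T i)) \<and>
        \<comment> \<open>C0\<close>
        (n \<ge> 1 \<and> T 1 = S \<and> W 1 = [] \<and> C 1 = mat 1) \<and>
        \<comment> \<open>C1\<close>
        (\<forall>i\<in>{1..n}. C i \<bullet>\<^sub>s S \<cong>\<^sub>t T i) \<and>
        \<comment> \<open>C2\<close>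
        (subgroup_index (veech_group P) (veech S) = n \<and>
         bij_betw (\<lambda>i. C i <#\<^bsub>veech_group P\<^esub> veech S) {1..n}
           (lcosets\<^bsub>veech_group P\<^esub> (veech S)) \<and>
         bij_betw (\<lambda>i. surface_class (T i)) {1..n}
           ((\<lambda>A. surface_class (A \<bullet>\<^sub>s S)) ` veech P)) \<and>
        \<comment> \<open>C3\<close>
        (\<forall>j\<in>{1..m}. dom (d j) = {1..n} \<and>
           bij_betw (\<lambda>i. the (d j i)) {1..n} {1..n} \<and>
           (\<forall>i\<in>{1..n}.
              M j \<bullet>\<^sub>s T i \<cong>\<^sub>t T (the (d j i)) \<and>
              (M j ** C i) <#\<^bsub>veech_group P\<^esub> veech S =
                C (the (d j i)) <#\<^bsub>veech_group P\<^esub> veech S))))"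
proof -
  have "veech P \<subseteq> carrier SL2R" by (auto simp: veech_def)
  then interpret orbit_enumeration S "veech P" M m
    using assms by (intro orbit_enumeration.intro) (simp_all add: veech_group_def)
  show ?thesis
    unfolding veech_group_def
  proof (intro conjI allI impI)
    show "alg_terminates M m S" by (rule terminates)
  next
    fix n W T d assume "alg_output M m S n W T d"
    then obtain s where reach: "alg_reachable M m S s" and halt: "alg_halted s"
      and eq: "n = num s" "W = word s" "T = surf s" "d = dict s"
      unfolding alg_output_def by blast
    have inv: "invariant s" using reach by (rule invariant_reachable)
    have C1: "word_matrix M (word s i) \<bullet>\<^sub>s S \<cong>\<^sub>t surf s i" if "i \<in> {1..num s}" for i
      using same_surface_refl[OF invariant_surface(2)[OF inv that]]
        invariantD(5)[OF inv that] by simp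
    show "let C = (\<lambda>i. word_matrix M (W i)) in
        (\<forall>i\<in>{1..n}. set (W i) \<subseteq> {1..m} \<and> C i \<in> veech P \<and> translation_surface (T i)) \<and>
        (n \<ge> 1 \<and> T 1 = S \<and> W 1 = [] \<and> C 1 = mat 1) \<and>
        (\<forall>i\<in>{1..n}. C i \<bullet>\<^sub>s S \<cong>\<^sub>t T i) \<and>
        (subgroup_index G (veech S) = n \<and>
         bij_betw (\<lambda>i. C i <#\<^bsub>G\<^esub> veech S) {1..n} (lcosets\<^bsub>G\<^esub> (veech S)) \<and>
         bij_betw (\<lambda>i. surface_class (T i)) {1..n}
           ((\<lambda>A. surface_class (A \<bullet>\<^sub>s S)) ` veech P)) \<and>
        (\<forall>j\<in>{1..m}. dom (d j) = {1..n} \<and>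
           bij_betw (\<lambda>i. the (d j i)) {1..n} {1..n} \<and>
           (\<forall>i\<in>{1..n}.
              M j \<bullet>\<^sub>s T i \<cong>\<^sub>t T (the (d j i)) \<and>
              (M j ** C i) <#\<^bsub>G\<^esub> veech S = C (the (d j i)) <#\<^bsub>G\<^esub> veech S))"
      unfolding Let_def eq
    proof (intro conjI ballI)
      show "subgroup_index G (veech S) = num s"
        using bij_betw_same_card[OF halted_lcosets[OF inv halt]] by (simp add: subgroup_index_def)
    qed (use invariantD(1-4)[OF inv] invariant_surface[OF inv] C1 halted_lcosets[OF inv halt]
          halted_orbit[OF inv halt] halted_dict[OF inv halt] halted_dict_lcoset[OF inv halt]
        in \<open>simp_all\<close>)
  qed
qed

end
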